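(* Let $N\ge 2$ be an integer and let $(c(x,x+1))_{1\le x<N}$ be any sequence with $c(x,x+1)>0$ for all $x$. Then: (1) The operator $-\Delta^{(c)}$ admits $N$ distinct eigenvalues $0=\lambda_0<\lambda_1<\dots<\lambda_{N-1}$. (2) If $(g_j)_{j=0}^{N-1}$ is a basis of eigenfunctions of $-\Delta^{(c)}$ with respective eigenvalues $\lambda_j$, then $g_1$ is strictly monotone, and for every $2\le j\le N-1$, $g_j$ is $j$-monotone.
   Context: For $f:\{1,\dots,N\}\to\mathbb R$, set $(c\nabla f)(x)=c(x-1,x)[f(x)-f(x-1)]$ for $2\le x\le N$, with the convention $(c\nabla f)(1)=(c\nabla f)(N+1)=0$, and $(\Delta^{(c)}f)(x)=(c\nabla f)(x+1)-(c\nabla f)(x)$ for $1\le x\le N$. Write $[[b,d]]=[b,d]\cap\mathbb Z$. Given $f:[[1,N]]\to\mathbb R$ and integers $2\le b\le d\le N-1$, $f$ admits a local maximum (respectively minimum) at $[[b,d]]$ if $f$ is constant on $[[b,d]]$ and $f(b-1)<f(b)$ and $f(d)>f(d+1)$ (respectively $f(b-1)>f(b)$ and $f(d)<f(d+1)$). A local extremum is a local maximum or a local minimum. For $j\ge 2$, $f$ is $j$-monotone if it displays exactly $j-1$ distinct local extrema (i.e. there are exactly $j-1$ such intervals) in $[[2,N-1]]$. *)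

theory Defs
  imports "HOL-Analysis.Analysis" "HOL-Library.Function_Algebras"
begin

text \<open>
  A function on $\{1,\dots,N\}$ is represented by its extension by zero to all of \<^typ>\<open>nat\<close>.
\<close>

definition fun_space :: "nat \<Rightarrow> (nat \<Rightarrow> real) set" where
  "fun_space N = {f. \<forall>x. x \<notin> {1..N} \<longrightarrow> f x = 0}"

definition fscale :: "real \<Rightarrow> (nat \<Rightarrow> real) \<Rightarrow> nat \<Rightarrow> real" where
  "fscale a f = (\<lambda>x. a * f x)"

global_interpretation fs: vector_space fscale
  by unfold_locales (auto simp: fscale_def fun_eq_iff algebra_simps)

lemma subspace_fun_space: "fs.subspace (fun_space N)"
  by (auto simp: fs.subspace_def fun_space_def fscale_def)

text \<open>
  Only the conductances \<open>c x (x + 1)\<close> with \<open>1 \<le> x < N\<close> are ever used. The value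
  zero at \<open>x = 1\<close> and \<open>x = N + 1\<close> is the boundary convention.
\<close>

definition c_nabla :: "nat \<Rightarrow> (nat \<Rightarrow> nat \<Rightarrow> real) \<Rightarrow> (nat \<Rightarrow> real) \<Rightarrow> nat \<Rightarrow> real" where
  "c_nabla N c f x = (if 2 \<le> x \<and> x \<le> N then c (x - 1) x * (f x - f (x - 1)) else 0)"

definition c_laplacian :: "nat \<Rightarrow> (nat \<Rightarrow> nat \<Rightarrow> real) \<Rightarrow> (nat \<Rightarrow> real) \<Rightarrow> nat \<Rightarrow> real" where
  "c_laplacian N c f x =
     (if x \<in> {1..N} then c_nabla N c f (x + 1) - c_nabla N c f x else 0)"

lemma c_laplacian_in_fun_space: "c_laplacian N c f \<in> fun_space N"
  by (auto simp: fun_space_def c_laplacian_def)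

definition eigenfunction ::
  "nat \<Rightarrow> ((nat \<Rightarrow> real) \<Rightarrow> (nat \<Rightarrow> real)) \<Rightarrow> real \<Rightarrow> (nat \<Rightarrow> real) \<Rightarrow> bool" where
  "eigenfunction N T \<mu> f \<longleftrightarrow> f \<in> fun_space N \<and> f \<noteq> 0 \<and> T f = fscale \<mu> f"

definition eigenvalues :: "nat \<Rightarrow> ((nat \<Rightarrow> real) \<Rightarrow> (nat \<Rightarrow> real)) \<Rightarrow> real set" where
  "eigenvalues N T = {\<mu>. \<exists>f. eigenfunction N T \<mu> f}"

definition is_basis :: "nat \<Rightarrow> (nat \<Rightarrow> nat \<Rightarrow> real) \<Rightarrow> bool" where
  "is_basis N g \<longleftrightarrow> inj_on g {..<N} \<and> fs.independent (g ` {..<N}) \<and>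
     fs.span (g ` {..<N}) = fun_space N"

definition local_max_at :: "(nat \<Rightarrow> real) \<Rightarrow> nat \<Rightarrow> nat \<Rightarrow> bool" where
  "local_max_at f b d \<longleftrightarrow> f constant_on {b..d} \<and> f (b - 1) < f b \<and> f d > f (d + 1)"

definition local_min_at :: "(nat \<Rightarrow> real) \<Rightarrow> nat \<Rightarrow> nat \<Rightarrow> bool" where
  "local_min_at f b d \<longleftrightarrow> f constant_on {b..d} \<and> f (b - 1) > f b \<and> f d < f (d + 1)"

definition local_extrema :: "nat \<Rightarrow> (nat \<Rightarrow> real) \<Rightarrow> (nat \<times> nat) set" where
  "local_extrema N f =
     {(b, d). 2 \<le> b \<and> b \<le> d \<and> d \<le> N - 1 \<and> (local_max_at f b d \<or> local_min_at f b d)}"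

definition j_monotone :: "nat \<Rightarrow> nat \<Rightarrow> (nat \<Rightarrow> real) \<Rightarrow> bool" where
  "j_monotone N j f \<longleftrightarrow> j \<ge> 2 \<and> card (local_extrema N f) = j - 1"

end

(*
  For an eigenfunction f with eigenvalue mu the flux h = c nabla f satisfies
  h(x+1) - 2 h(x) + h(x-1) = - mu h(x) / c(x-1,x) with h(1) = 0 and h(2) = - mu f(1), so
  h(k+1) = - mu f(1) S_k(mu) for the Sturm sequence S_0 = 0, S_1 = 1,
  S_{k+2} = (2 - w_k mu) S_{k+1} - S_k with w_k = 1 / c(k+1,k+2). The boundary condition h(N+1) = 0
  makes the nonzero eigenvalues the roots of S_N. The number of sign changes in S_1(t), ..., S_N(t)
  is the number of roots of S_N below t, and sign changes of the flux of f are the local extrema of f.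
*)

theory Submission
  imports Defs
begin

section \<open>Sturm sequences and their sign changes\<close>

text \<open>The polynomials are in the spectral parameter. For constant weight 1 they are the
  Chebyshev polynomials of the second kind \<open>U_(k-1)(1 - t/2)\<close>.\<close>

fun sturm :: "(nat \<Rightarrow> real) \<Rightarrow> nat \<Rightarrow> real poly" where
  "sturm w 0 = 0"
| "sturm w (Suc 0) = 1"
| "sturm w (Suc (Suc k)) = [:2, - w k:] * sturm w (Suc k) - sturm w k"

text \<open>
  A zero of a Sturm sequence is isolated and lies between values of opposite signs. The sign change
  across it is attributed to the zero itself, not to the step into it.
\<close>

definition change_at :: "(nat \<Rightarrow> real) \<Rightarrow> nat \<Rightarrow> bool" where
  "change_at a k \<longleftrightarrow> a k * a (Suc k) < 0 \<or> a k = 0"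

definition changes :: "nat \<Rightarrow> (nat \<Rightarrow> real) \<Rightarrow> nat" where
  "changes n a = card {k \<in> {1..n}. change_at a k}"

lemma changes_0 [simp]: "changes 0 a = 0"
  by (simp add: changes_def)

lemma changes_Suc:
  "changes (Suc n) a = changes n a + (if change_at a (Suc n) then 1 else 0)"
proof -
  have "{k \<in> {1..Suc n}. change_at a k} =
    (if change_at a (Suc n) then insert (Suc n) {k \<in> {1..n}. change_at a k}
     else {k \<in> {1..n}. change_at a k})"
    by (auto simp: le_Suc_eq)
  then show ?thesis
    by (simp add: changes_def)
qed

lemma poly_sturm_Suc_Suc:
  "poly (sturm w (Suc (Suc k))) t =
     (2 - t * w k) * poly (sturm w (Suc k)) t - poly (sturm w k) t"
  by (simp add: algebra_simps)

text \<open>Each step adds \<open>- t * w k\<close> times the current value to the increment, which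
  is nonnegative for \<open>t \<le> 0\<close>. Only \<open>t = 0\<close> matters later: it gives the
  sign to the left of all roots.\<close>

lemma sturm_increasing:
  assumes "\<And>k. 0 < w k" "t \<le> 0"
  shows "0 \<le> poly (sturm w k) t \<and> poly (sturm w k) t < poly (sturm w (Suc k)) t"
proof (induction k)
  case 0
  then show ?case by simp
next
  case (Suc k)
  have "t * w k \<le> 0"
    using assms(1)[of k] assms(2) by (simp add: mult_nonpos_nonneg)
  then have "t * w k * poly (sturm w (Suc k)) t \<le> 0"
    by (rule mult_nonpos_nonneg) (use Suc in linarith)
  then show ?case
    using Suc unfolding poly_sturm_Suc_Suc by (simp add: left_diff_distrib del: sturm.simps)
qed

lemma degree_sturm: "degree (sturm w k) \<le> k - 1"
proof (induction w k rule: sturm.induct)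
  case (3 w k)
  have "degree ([:2, - w k:] * sturm w (Suc k)) \<le> 1 + k"
    by (rule order_trans[OF degree_mult_le add_mono]) (use 3 in auto)
  with 3 show ?case
    by (auto intro!: degree_diff_le simp del: mult_pCons_left)
qed auto

text \<open>Each recurrence step contributes a leading factor \<open>- w n\<close>. This fixes the
  exact degree and the sign for large arguments.\<close>

lemma coeff_sturm_top:
  assumes "\<And>k. 0 < w k"
  shows "0 < (-1) ^ n * coeff (sturm w (Suc n)) n"
proof (induction n)
  case 0
  then show ?case by simp
next
  case (Suc n)
  have "coeff (sturm w (Suc n)) (Suc n) = 0" "coeff (sturm w n) (Suc n) = 0"
    using degree_sturm[of w "Suc n"] degree_sturm[of w n] by (auto intro!: coeff_eq_0)
  then have "(-1) ^ Suc n * coeff (sturm w (Suc (Suc n))) (Suc n) =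
      w n * ((-1) ^ n * coeff (sturm w (Suc n)) n)"
    by simp
  also have "0 < \<dots>"
    using Suc assms by simp
  finally show ?case .
qed

text \<open>Two consecutive zeros would propagate down the recurrence to the constant polynomial
  1.\<close>

lemma sturm_no_double_zero:
  assumes "poly (sturm w k) t = 0"
  shows "poly (sturm w (Suc k)) t \<noteq> 0"
  using assms
proof (induction k)
  case (Suc k)
  then show ?case unfolding poly_sturm_Suc_Suc by auto
qed auto

text \<open>The sequence starts at 1 and each change flips its sign. The two-step induction passes
  over a zero, whose neighbours are opposite by the recurrence and across which one change is
  counted.\<close>

lemma sgn_sturm:
  assumes "poly (sturm w (Suc n)) t \<noteq> 0"
  shows "sgn (poly (sturm w (Suc n)) t) = (-1) ^ changes n (\<lambda>k. poly (sturm w k) t)"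
  using assms
proof (induction n rule: induct_nat_012)
  case (ge2 n)
  let ?p = "\<lambda>k. poly (sturm w k) t"
  show ?case
  proof (cases "?p (Suc (Suc n)) = 0")
    case True
    then have nz: "?p (Suc n) \<noteq> 0" "?p (Suc (Suc (Suc n))) = - ?p (Suc n)"
      using sturm_no_double_zero[of w "Suc n" t] ge2.prems
      unfolding poly_sturm_Suc_Suc[of w "Suc n"] by auto
    have "changes (Suc (Suc n)) ?p = Suc (changes n ?p)"
      using True nz by (simp add: changes_Suc change_at_def del: sturm.simps)
    then show ?thesis using ge2.IH(1) nz by (simp add: sgn_minus del: sturm.simps)
  next
    case False
    then show ?thesis
      using ge2.IH(2) ge2.prems
      by (subst changes_Suc)
        (auto simp: change_at_def mult_less_0_iff sgn_if split: if_splits simp del: sturm.simps)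
  qed
next
  case 1
  then show ?case by (subst changes_Suc) (auto simp: change_at_def sgn_if)
qed auto

section \<open>Roots of the Sturm polynomials\<close>

text \<open>With this many roots, \<open>p\<close> is a positive multiple of the product of the
  factors \<open>s i - t\<close>, and a factor is negative exactly when its root lies below
  \<open>t\<close>.\<close>

lemma sgn_poly_roots:
  fixes p :: "real poly"
  assumes deg: "degree p \<le> n" and top: "0 < (-1) ^ n * coeff p n"
    and inj: "inj_on s {1..n}" and roots: "\<And>i. i \<in> {1..n} \<Longrightarrow> poly p (s i) = 0"
  shows "{t. poly p t = 0} = s ` {1..n}"
    and "poly p t \<noteq> 0 \<Longrightarrow> sgn (poly p t) = (-1) ^ card {i \<in> {1..n}. s i < t}"
proof -
  have nz: "p \<noteq> 0" using top by auto
  have fin: "finite {t. poly p t = 0}" using nz by (rule poly_roots_finite)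
  have sub: "s ` {1..n} \<subseteq> {t. poly p t = 0}" using roots by auto
  have "card {t. poly p t = 0} \<le> n"
    using card_poly_roots_bound[OF nz] deg by linarith
  then have "card {t. poly p t = 0} \<le> card (s ` {1..n})"
    using inj by (simp add: card_image)
  then show eq: "{t. poly p t = 0} = s ` {1..n}"
    using card_seteq[OF fin sub] by simp
  let ?K = "(-1) ^ n * coeff p n"
  \<comment> \<open>Factors \<open>s i - t\<close> rather than \<open>t - s i\<close> give leading
    coefficient \<open>(-1)^n\<close>, so the multiple \<open>?K\<close> is the quantity assumed
    positive.\<close>
  define q where "q = (\<Prod>i\<in>{1..n}. [:s i, -1:])"
  have degq: "degree q = n" by (simp add: q_def degree_prod_eq_sum_degree)
  have "lead_coeff q = (\<Prod>i\<in>{1..n}. lead_coeff [:s i, -1:])"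
    unfolding q_def by (rule lead_coeff_prod)
  then have cq: "coeff q n = (-1) ^ n" using degq by simp
  \<comment> \<open>A nonzero difference would have \<open>n\<close> roots but degree below
    \<open>n\<close>.\<close>
  have pq: "p - smult ?K q = 0"
  proof (rule ccontr)
    assume d: "p - smult ?K q \<noteq> 0"
    have "coeff (p - smult ?K q) n = 0"
      by (cases "even n") (simp_all add: cq)
    moreover have "degree (p - smult ?K q) \<le> n"
      using deg degq by (intro degree_diff_le) auto
    ultimately have less: "degree (p - smult ?K q) < n"
      using d by (metis leading_coeff_0_iff le_neq_implies_less)
    have "poly q (s i) = 0" if "i \<in> {1..n}" for i
      using that by (auto simp: q_def poly_prod)
    then have "s ` {1..n} \<subseteq> {t. poly (p - smult ?K q) t = 0}" using roots by auto
    from card_mono[OF poly_roots_finite[OF d] this]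
    have "n \<le> card {t. poly (p - smult ?K q) t = 0}"
      using inj by (simp only: card_image card_atLeastAtMost diff_Suc_1)
    then show False using card_poly_roots_bound[OF d] less by linarith
  qed
  have val: "poly p t = ?K * (\<Prod>i\<in>{1..n}. s i - t)"
  proof -
    have "poly p t = poly (smult ?K q) t" using pq by (metis eq_iff_diff_eq_0)
    also have "\<dots> = ?K * (\<Prod>i\<in>{1..n}. s i - t)" by (simp add: q_def poly_prod)
    finally show ?thesis .
  qed
  have prod_sgn: "sgn (prod h A) = (\<Prod>i\<in>A. sgn (h i))" for h :: "nat \<Rightarrow> real" and A
    by (induction A rule: infinite_finite_induct) (simp_all add: sgn_mult)
  assume pt: "poly p t \<noteq> 0"
  have "sgn (poly p t) = sgn ?K * (\<Prod>i\<in>{1..n}. sgn (s i - t))"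
    unfolding val sgn_mult
    by (simp add: prod_sgn[of "\<lambda>i. s i - t"])
  also have "\<dots> = (\<Prod>i\<in>{1..n}. if s i < t then - 1 else 1)"
  proof -
    have "s i \<noteq> t" if "i \<in> {1..n}" for i using that pt roots by auto
    then show ?thesis using top by (auto simp: sgn_if intro!: prod.cong)
  qed
  also have "\<dots> = (-1) ^ card {i \<in> {1..n}. s i < t}"
    by (simp add: prod.If_cases Int_def conj_commute)
  finally show "sgn (poly p t) = (-1) ^ card {i \<in> {1..n}. s i < t}" .
qed

text \<open>
  Each Sturm polynomial has sign \<open>(-1)^i\<close> at the \<open>i\<close>-th root of its predecessor, so the intermediate value theorem locates all roots of the next polynomial. Going from
  \<open>n\<close> to \<open>n + 1\<close> raises both the number of sign changes and the number of smaller roots by 0 or 1,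
  and their parities agree because both are read off from the sign of the new polynomial.
  The value \<open>r 0 = 0\<close> is not a root; it is a lower bound for the roots.
\<close>

lemma sturm_roots:
  assumes w: "\<And>k. 0 < w k"
  shows "\<exists>r. r 0 = 0 \<and> strict_mono_on {0..n} r \<and>
    {t. poly (sturm w (Suc n)) t = 0} = r ` {1..n} \<and>
    (\<forall>t. changes n (\<lambda>k. poly (sturm w k) t) = card {i \<in> {1..n}. r i < t})"
proof (induction n)
  case 0
  show ?case by (rule exI[of _ "\<lambda>_. 0"]) (auto simp: strict_mono_on_def)
next
  case (Suc n)
  let ?p = "sturm w (Suc (Suc n))"
  let ?V = "\<lambda>n t. changes n (\<lambda>k. poly (sturm w k) t)"
  obtain r where r0: "r 0 = 0" and mono: "strict_mono_on {0..n} r"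
    and zeros: "{t. poly (sturm w (Suc n)) t = 0} = r ` {1..n}"
    and count: "\<And>t. ?V n t = card {i \<in> {1..n}. r i < t}"
    using Suc by blast
  have r_less: "r i < r j \<longleftrightarrow> i < j" if "i \<le> n" "j \<le> n" for i j
    using strict_mono_on_less[OF mono] that by simp
  \<comment> \<open>For \<open>i > 0\<close>, \<open>i - 1\<close> roots lie below
    \<open>r i\<close>, and the zero at index \<open>Suc n\<close> counts as one further
    change.\<close>
  have sgn_r: "sgn (poly ?p (r i)) = (-1) ^ i" if "i \<le> n" for i
  proof (cases "i = 0")
    case True
    then show ?thesis
      using sturm_increasing[of w 0 "Suc n", OF w] r0 by (auto simp del: sturm.simps)
  next
    case False
    then have z: "poly (sturm w (Suc n)) (r i) = 0" using that zeros by auto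
    have "{j \<in> {1..n}. r j < r i} = {1..<i}" using that by (auto simp: r_less)
    then have "?V (Suc n) (r i) = i" 
      using False z count by (simp add: changes_Suc change_at_def)
    then show ?thesis using sgn_sturm[OF sturm_no_double_zero[OF z]] by simp
  qed
  have deg: "degree ?p \<le> Suc n" using degree_sturm[of w "Suc (Suc n)"] by simp
  have top: "0 < (-1) ^ Suc n * coeff ?p (Suc n)" by (rule coeff_sturm_top[OF w])
  obtain B where B: "r n < B" "sgn (poly ?p B) = (-1) ^ Suc n"
  proof -
    let ?q = "smult ((-1) ^ Suc n) ?p"
    have "degree ?p = Suc n" using deg top le_degree[of ?p "Suc n"] by fastforce
    then have pos: "0 < lead_coeff ?q" using top by (simp del: sturm.simps)
    then obtain b where b: "\<And>x. b \<le> x \<Longrightarrow> lead_coeff ?q \<le> poly ?q x"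
      using poly_pinfty_gt_lc by blast
    let ?B = "max b (r n + 1)"
    have "0 < poly ?q ?B" using b[of ?B] pos by linarith
    then have "0 < (-1) ^ Suc n * poly ?p ?B" by (simp only: poly_smult)
    then have "sgn (poly ?p ?B) = (-1) ^ Suc n"
      by (cases "even n") (auto simp: sgn_if simp del: sturm.simps)
    then show ?thesis using that[of ?B] by simp
  qed
  \<comment> \<open>The points \<open>e 0\<close>, ..., \<open>e (Suc n)\<close> are 0, the old
    roots and \<open>B\<close>; the signs of \<open>?p\<close> alternate along them.\<close>
  define e where "e i = (if i \<le> n then r i else B)" for i
  have ex: "\<exists>x. e (i - 1) < x \<and> x < e i \<and> poly ?p x = 0" if i: "i \<in> {1..Suc n}" for i
  proof -
    obtain j where j: "i = Suc j" "j \<le> n" using i by (cases i) auto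
    have less: "e j < e i"
      using j B r_less[of j i] by (cases "i \<le> n") (auto simp: e_def le_antisym not_less_eq_eq)
    have s: "sgn (poly ?p (e k)) = (-1) ^ k" if "k \<le> Suc n" for k
      using that sgn_r[of k] B by (cases "k = Suc n") (auto simp: e_def simp del: sturm.simps)
    have "sgn (poly ?p (e j) * poly ?p (e i)) < 0"
      unfolding sgn_mult using s[of j] s[of i] j by (simp del: sturm.simps)
    then have "poly ?p (e j) * poly ?p (e i) < 0" by (simp add: sgn_less del: sturm.simps)
    from poly_IVT[OF less this] show ?thesis using j by (auto simp del: sturm.simps)
  qed
  then have "\<exists>s. \<forall>i\<in>{1..Suc n}. e (i - 1) < s i \<and> s i < e i \<and> poly ?p (s i) = 0"
    by (intro bchoice) blast
  then obtain s' where s':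
    "\<And>i. i \<in> {1..Suc n} \<Longrightarrow> e (i - 1) < s' i \<and> s' i < e i \<and> poly ?p (s' i) = 0"
    by blast
  \<comment> \<open>The choice says nothing about index 0, where the convention of a lower bound 0
    has to be restored.\<close>
  define s where "s = s'(0 := 0)"
  have lower: "r j < s i" if "j < i" "i \<le> Suc n" for i j
  proof -
    have "r j \<le> r (i - 1)" using that r_less[of j "i - 1"] 
      by (cases "j = i - 1") (simp_all add: order_less_imp_le)
    then show ?thesis using s'[of i] that by (auto simp: s_def e_def split: if_splits)
  qed
  have upper: "s i < r j" if "1 \<le> i" "i \<le> j" "j \<le> n" for i j
  proof -
    have "r i \<le> r j" using that r_less[of i j] by (cases "j = i") auto
    then show ?thesis using s'[of i] that by (auto simp: s_def e_def split: if_splits)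
  qed
  have roots: "poly ?p (s i) = 0" if "i \<in> {1..Suc n}" for i
    using s'[OF that] that by (auto simp: s_def simp del: sturm.simps)
  have mono_s: "strict_mono_on {0..Suc n} s"
  proof (rule strict_mono_onI)
    fix i j assume ij: "i \<in> {0..Suc n}" "j \<in> {0..Suc n}" "i < j"
    then show "s i < s j"
      using lower[of 0 j] lower[of i j] upper[of i i] r0 by (cases "i = 0") (auto simp: s_def)
  qed
  then have inj: "inj_on s {1..Suc n}"
    by (meson atLeastatMost_subset_iff inj_on_subset strict_mono_on_imp_inj_on zero_le_one order_refl)
  note zeros_s = sgn_poly_roots(1)[OF deg top inj roots]
  have sgn_s: "sgn (poly ?p t) = (-1) ^ card {i \<in> {1..Suc n}. s i < t}" if "poly ?p t \<noteq> 0" for t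
    by (rule sgn_poly_roots(2)[OF deg top inj _ that]) (rule roots)
  have "?V (Suc n) t = card {i \<in> {1..Suc n}. s i < t}" for t
  proof (cases "poly ?p t = 0")
    case True
    then obtain j where j: "j \<in> {1..Suc n}" "t = s j" using zeros_s by blast
    \<comment> \<open>At the \<open>j\<close>-th new root, interlacing leaves \<open>j - 1\<close>
      smaller roots of either polynomial, and the step into a zero is not a change.\<close>
    have "{i \<in> {1..Suc n}. s i < t} = {1..<j}"
      using j strict_mono_on_less[OF mono_s] by auto
    moreover have "{i \<in> {1..n}. r i < t} = {1..<j}"
      using j lower[of _ j] upper[of j] by (auto simp: not_less dest: less_asym)
    moreover have "?V (Suc n) t = ?V n t"
      using True sturm_no_double_zero[of w "Suc n" t]
      by (auto simp: changes_Suc change_at_def simp del: sturm.simps)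
    ultimately show ?thesis using count by simp
  next
    case False
    let ?R = "{i \<in> {1..n}. r i < t}" and ?S = "{i \<in> {1..Suc n}. s i < t}"
    have "?R \<subseteq> ?S" using upper by force
    then have 1: "card ?R \<le> card ?S" by (intro card_mono) auto
    \<comment> \<open>Below a new root \<open>s i\<close> with \<open>i > 1\<close> lies the old
      root \<open>r (i - 1)\<close>.\<close>
    have "?S \<subseteq> insert 1 (Suc ` ?R)"
    proof
      fix i assume i: "i \<in> ?S"
      then show "i \<in> insert 1 (Suc ` ?R)"
        using lower[of "i - 1" i] by (cases "i = 1") (auto intro!: image_eqI[of _ _ "i - 1"])
    qed
    then have "card ?S \<le> card (insert 1 (Suc ` ?R))" by (intro card_mono) auto
    also have "\<dots> \<le> Suc (card ?R)" by (simp add: card_insert_if card_image)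
    finally have 2: "card ?S \<le> Suc (card ?R)" .
    have "(-1 :: real) ^ ?V (Suc n) t = (-1) ^ card ?S"
      using sgn_sturm[OF False] sgn_s[OF False] by simp
    then have "even (?V (Suc n) t) \<longleftrightarrow> even (card ?S)"
      by (simp add: uminus_power_if split: if_splits)
    moreover have "?V (Suc n) t = card ?R \<or> ?V (Suc n) t = Suc (card ?R)"
      using changes_Suc count by simp
    moreover have "card ?S = card ?R \<or> card ?S = Suc (card ?R)" using 1 2 by linarith
    ultimately show ?thesis by auto
  qed
  moreover have "s 0 = 0" by (simp add: s_def)
  ultimately show ?case using mono_s zeros_s by blast
qed

section \<open>Local extrema as sign changes of increments\<close>

text \<open>
  Since zeros of the increments are isolated, a local extremum at \<open>[[b, d]]\<close> has \<open>d = b\<close> or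
  \<open>d = b + 1\<close>, and \<open>d - 1\<close> is the position of the sign change.
\<close>

lemma card_local_extrema:
  fixes f :: "nat \<Rightarrow> real"
  defines "D \<equiv> \<lambda>x. f (Suc x) - f x"
  assumes first: "D 1 \<noteq> 0" and last: "D (N - 1) \<noteq> 0"
    and zero: "\<And>x. 2 \<le> x \<Longrightarrow> Suc x < N \<Longrightarrow> D x = 0 \<Longrightarrow> D (x - 1) * D (Suc x) < 0"
  shows "card (local_extrema N f) = card {k \<in> {1..<N - 1}. change_at D k}"
proof -
  \<comment> \<open>A zero increment at \<open>k\<close> yields the plateau from \<open>k\<close> to
    \<open>Suc k\<close>; a strict change yields the single point \<open>Suc k\<close>.\<close>
  let ?F = "\<lambda>k. (if D k = 0 then k else Suc k, Suc k)"
  have ext: "local_max_at f b d \<or> local_min_at f b d \<longleftrightarrow>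
      f constant_on {b..d} \<and> D (b - 1) * D d < 0" if "2 \<le> b" for b d
    using that by (auto simp: local_max_at_def local_min_at_def D_def mult_less_0_iff)
  have "local_extrema N f = ?F ` {k \<in> {1..<N - 1}. change_at D k}" (is "_ = ?F ` ?A")
  proof (intro equalityI subsetI)
    fix z assume "z \<in> local_extrema N f"
    then obtain b d where z: "z = (b, d)" "2 \<le> b" "b \<le> d" "d \<le> N - 1"
      and const: "f constant_on {b..d}" and prod: "D (b - 1) * D d < 0"
      unfolding local_extrema_def using ext by auto
    have D0: "D x = 0" if "b \<le> x" "x < d" for x
      using const that by (auto simp: constant_on_def D_def)
    have "d \<le> Suc b"
    proof (rule ccontr)
      assume "\<not> ?thesis"
      then have "D b = 0" "D (Suc b) = 0" using D0 by auto
      moreover have "Suc b < N" using z(4) \<open>\<not> d \<le> Suc b\<close> by linarith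
      ultimately show False using zero[of b] z(2) by simp
    qed
    then consider "d = b" | "d = Suc b" using z by linarith
    then show "z \<in> ?F ` ?A"
    proof cases
      case 1
      then show ?thesis using z prod
        by (intro image_eqI[of _ _ "b - 1"]) (auto simp: change_at_def)
    next
      case 2
      then show ?thesis using z D0[of b]
        by (intro image_eqI[of _ _ b]) (auto simp: change_at_def)
    qed
  next
    fix z assume "z \<in> ?F ` ?A"
    then obtain k where k: "z = ?F k" "1 \<le> k" "k < N - 1" "change_at D k" by auto
    show "z \<in> local_extrema N f"
    proof (cases "D k = 0")
      case True
      \<comment> \<open>Index 1 is excluded by \<open>first\<close>, so \<open>zero\<close> applies
        and gives increments of opposite signs on both sides of the plateau.\<close>
      then have "2 \<le> k" using k first by (cases "k = 1") auto
      moreover have "D (k - 1) * D (Suc k) < 0" using zero True k calculation by simp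
      moreover have "f constant_on {k..Suc k}"
        using True by (auto simp: constant_on_def D_def atLeastAtMostSuc_conv)
      ultimately show ?thesis
        using True k ext[of k "Suc k"] by (auto simp: local_extrema_def)
    next
      case False
      then have "D k * D (Suc k) < 0" using k by (auto simp: change_at_def)
      moreover have "f constant_on {Suc k..Suc k}" by (auto simp: constant_on_def)
      ultimately show ?thesis
        using False k ext[of "Suc k" "Suc k"] by (auto simp: local_extrema_def)
    qed
  qed
  moreover have "inj_on ?F ?A" by (auto simp: inj_on_def)
  ultimately show ?thesis by (simp add: card_image)
qed

lemma strict_mono_on_atLeastAtMostI:
  fixes f :: "nat \<Rightarrow> real"
  assumes "\<And>x. a \<le> x \<Longrightarrow> x < b \<Longrightarrow> f x < f (Suc x)"
  shows "strict_mono_on {a..b} f"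
proof (rule strict_mono_onI)
  fix x y assume "x \<in> {a..b}" "y \<in> {a..b}" "x < y"
  then have "a \<le> x" "Suc x \<le> y" "y \<le> b" by auto
  from this(2,3) show "f x < f y"
  proof (induction y rule: dec_induct)
    case base
    then show ?case using assms \<open>a \<le> x\<close> by simp
  next
    case (step z)
    then show ?case using assms[of z] \<open>a \<le> x\<close> by fastforce
  qed
qed

section \<open>Eigenfunctions through their flux\<close>

locale conductances =
  fixes N :: nat and c :: "nat \<Rightarrow> nat \<Rightarrow> real"
  assumes N: "N \<ge> 2"
    and c: "\<And>x. 1 \<le> x \<Longrightarrow> x < N \<Longrightarrow> c x (x + 1) > 0"
begin

text \<open>Edge resistances, shifted so that index 0 is the first edge. The default 1 beyond the
  path keeps all weights positive, as \<open>sturm_roots\<close> demands.\<close>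

definition w :: "nat \<Rightarrow> real" where
  "w k = (if Suc k < N then 1 / c (Suc k) (Suc (Suc k)) else 1)"

lemma w: "Suc k < N \<Longrightarrow> w k = 1 / c (Suc k) (Suc (Suc k))"
  by (simp add: w_def)

lemma w_pos: "0 < w k"
  using c[of "Suc k"] by (simp add: w_def)

text \<open>Subtracting the eigenvalue equations at neighbouring points gives the Sturm recurrence
  for the flux. If \<open>f 1\<close> vanished, so would all increments and hence
  \<open>f\<close>.\<close>

lemma eigenfunction_flux:
  assumes ef: "eigenfunction N (\<lambda>f. - c_laplacian N c f) \<mu> f"
  shows "f 1 \<noteq> 0"
    and "\<mu> * poly (sturm w N) \<mu> = 0"
    and "1 \<le> x \<Longrightarrow> x < N \<Longrightarrow>
      f (Suc x) - f x = - \<mu> * f 1 * w (x - 1) * poly (sturm w x) \<mu>"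
proof -
  let ?h = "c_nabla N c f"
  have h_Suc: "?h (Suc x) = ?h x - \<mu> * f x" if "1 \<le> x" "x \<le> N" for x
  proof -
    have "- c_laplacian N c f x = \<mu> * f x"
      using ef by (auto simp: eigenfunction_def fscale_def fun_eq_iff)
    then show ?thesis using that by (simp add: c_laplacian_def)
  qed
  have f_Suc: "f (Suc x) - f x = w (x - 1) * ?h (Suc x)" if "1 \<le> x" "x < N" for x
    using that c[of x] w[of "x - 1"] by (simp add: c_nabla_def)
  \<comment> \<open>The range includes \<open>k = N\<close>, where the formula meets the boundary
    condition.\<close>
  have h: "k \<le> N \<Longrightarrow> ?h (Suc k) = - \<mu> * f 1 * poly (sturm w k) \<mu>" for k
  proof (induction k rule: induct_nat_012)
    case 0
    then show ?case by (simp add: c_nabla_def)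
  next
    case 1
    then show ?case using h_Suc[of 1] N by (simp add: c_nabla_def)
  next
    case (ge2 k)
    have "?h (Suc (Suc (Suc k))) =
        2 * ?h (Suc (Suc k)) - ?h (Suc k) - \<mu> * (f (Suc (Suc k)) - f (Suc k))"
      using h_Suc[of "Suc (Suc k)"] h_Suc[of "Suc k"] ge2.prems by (simp add: algebra_simps)
    also have "f (Suc (Suc k)) - f (Suc k) = w k * ?h (Suc (Suc k))"
      using f_Suc[of "Suc k"] ge2.prems by simp
    finally show ?case
      using ge2 unfolding poly_sturm_Suc_Suc by (simp add: algebra_simps del: sturm.simps)
  qed
  show diff: "f (Suc x) - f x = - \<mu> * f 1 * w (x - 1) * poly (sturm w x) \<mu>"
    if "1 \<le> x" "x < N" for x
    using f_Suc[OF that] h[of x] that by simp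
  show f1: "f 1 \<noteq> 0"
  proof
    assume z: "f 1 = 0"
    have "x < N \<Longrightarrow> f (Suc x) = 0" for x
    proof (induction x)
      case (Suc x)
      then show ?case using diff[of "Suc x"] z by simp
    qed (use z in simp)
    then have "f x = 0" for x
      using ef by (cases "x \<in> {1..N}"; cases x) (auto simp: eigenfunction_def fun_space_def)
    then show False using ef by (auto simp: eigenfunction_def fun_eq_iff)
  qed
  have "?h (Suc N) = 0" by (simp add: c_nabla_def)
  then show "\<mu> * poly (sturm w N) \<mu> = 0" using h[of N] f1 by simp
qed

text \<open>The witness solves the flux formula for \<open>f\<close> under the normalization
  \<open>f 1 = 1\<close>; at eigenvalue 0 it is the constant 1 on the path.\<close>

lemma eigenfunction_sturm:
  assumes root: "\<mu> * poly (sturm w N) \<mu> = 0"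
  defines "f \<equiv> \<lambda>x. if x \<in> {1..N} then poly (sturm w x) \<mu> - poly (sturm w (x - 1)) \<mu> else 0"
  shows "eigenfunction N (\<lambda>f. - c_laplacian N c f) \<mu> f"
proof -
  have h: "c_nabla N c f (Suc k) = - \<mu> * poly (sturm w k) \<mu>" if k: "k \<le> N" for k
  proof -
    \<comment> \<open>Indices 0 and \<open>N\<close> are the boundary fluxes: one vanishes since
      \<open>sturm w 0 = 0\<close>, the other by \<open>root\<close>.\<close>
    consider "k = 0" | "k = N" | j where "k = Suc j" "k < N"
      using k not0_implies_Suc le_neq_implies_less by metis
    then show ?thesis
    proof cases
      case 3
      have "f (Suc k) - f k = - \<mu> * w j * poly (sturm w k) \<mu>"
        using 3 by (simp add: f_def poly_sturm_Suc_Suc left_diff_distrib del: sturm.simps(3))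
      then show ?thesis using 3 c[of k] w[of j] by (simp add: c_nabla_def field_simps)
    qed (use root in \<open>auto simp: c_nabla_def\<close>)
  qed
  have "- c_laplacian N c f x = \<mu> * f x" for x
  proof (cases "x \<in> {1..N}")
    case True
    then obtain y where y: "x = Suc y" "y < N" by (cases x) auto
    have "f x = poly (sturm w x) \<mu> - poly (sturm w y) \<mu>" using y by (simp add: f_def)
    then show ?thesis using h[of x] h[of y] y
      by (simp add: c_laplacian_def right_diff_distrib)
  next
    case False
    then show ?thesis by (auto simp: c_laplacian_def f_def)
  qed
  moreover have "f 1 = 1" using N by (simp add: f_def)
  then have "f \<noteq> 0" by auto
  ultimately show ?thesis
    by (auto simp: eigenfunction_def fscale_def fun_eq_iff) (auto simp: fun_space_def f_def)
qed

text \<open>Increments of \<open>f\<close> are Sturm values times positive weights and a common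
  nonzero constant, so both sequences have the same zeros and sign changes.\<close>

lemma eigenfunction_card_local_extrema:
  assumes ef: "eigenfunction N (\<lambda>f. - c_laplacian N c f) \<mu> f"
    and \<mu>: "\<mu> \<noteq> 0"
  shows "card (local_extrema N f) = changes (N - 1) (\<lambda>k. poly (sturm w k) \<mu>)"
proof -
  let ?p = "\<lambda>k. poly (sturm w k) \<mu>"
  note flux = eigenfunction_flux[OF ef]
  define D where "D x = f (Suc x) - f x" for x
  define A where "A = - \<mu> * f 1"
  have A: "A \<noteq> 0" using \<mu> flux(1) by (simp add: A_def)
  have D: "D x = A * w (x - 1) * ?p x" if "1 \<le> x" "x < N" for x
    using flux(3)[OF that] by (simp add: D_def A_def)
  have D0: "D x = 0 \<longleftrightarrow> ?p x = 0" if "1 \<le> x" "x < N" for x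
    using D[OF that] A w_pos[of "x - 1"] that by auto
  have neg: "D x * D y < 0 \<longleftrightarrow> ?p x * ?p y < 0" if "1 \<le> x" "x < N" "1 \<le> y" "y < N" for x y
  proof -
    have "D x * D y = (A\<^sup>2 * w (x - 1) * w (y - 1)) * (?p x * ?p y)"
      using D that by (simp add: power2_eq_square)
    moreover have "0 < A\<^sup>2 * w (x - 1) * w (y - 1)"
      using A w_pos[of "x - 1"] w_pos[of "y - 1"] that by simp
    ultimately show ?thesis by (metis mult_less_0_iff less_asym)
  qed
  have pN: "?p N = 0" using flux(2) \<mu> by simp
  then have last: "?p (N - 1) \<noteq> 0"
    using sturm_no_double_zero[of w "N - 1" \<mu>] N by auto
  have "card (local_extrema N f) = card {k \<in> {1..<N - 1}. change_at D k}"
    unfolding D_def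
  proof (rule card_local_extrema; fold D_def)
    show "D 1 \<noteq> 0" using D0[of 1] N by simp
    show "D (N - 1) \<noteq> 0" using D0[of "N - 1"] N last by simp
    fix x assume x: "2 \<le> x" "Suc x < N" "D x = 0"
    obtain y where y: "x = Suc y" using x by (cases x) auto
    have "?p x = 0" using D0 x by simp
    then have "?p y \<noteq> 0" "?p (Suc x) = - ?p y"
      using sturm_no_double_zero[of w y \<mu>] unfolding y poly_sturm_Suc_Suc by auto
    then have "?p y * ?p (Suc x) < 0"
      by (simp add: zero_less_mult_iff linorder_neq_iff del: sturm.simps) blast
    then show "D (x - 1) * D (Suc x) < 0" using neg[of y "Suc x"] x y by simp
  qed
  also have "{k \<in> {1..<N - 1}. change_at D k} = {k \<in> {1..N - 1}. change_at ?p k}"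
  proof -
    \<comment> \<open>The two counts differ in range by the index \<open>N - 1\<close>, where the
      step goes into the zero at \<open>N\<close>.\<close>
    have "\<not> change_at ?p (N - 1)" using pN last N by (simp add: change_at_def)
    moreover have "change_at D k \<longleftrightarrow> change_at ?p k" if "1 \<le> k" "k < N - 1" for k
      using D0[of k] neg[of k "Suc k"] that by (simp add: change_at_def del: sturm.simps)
    ultimately show ?thesis by (force simp: order_le_less)
  qed
  finally show ?thesis by (simp only: changes_def)
qed

text \<open>Without changes the Sturm values below index \<open>N\<close> stay positive like the
  first one, so all increments share the sign of \<open>- \<mu> * f 1\<close>.\<close>

lemma eigenfunction_monotone:
  assumes ef: "eigenfunction N (\<lambda>f. - c_laplacian N c f) \<mu> f"
    and \<mu>: "\<mu> \<noteq> 0"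
    and no_change: "changes (N - 1) (\<lambda>k. poly (sturm w k) \<mu>) = 0"
  shows "strict_mono_on {1..N} f \<or> strict_antimono_on {1..N} f"
proof -
  let ?p = "\<lambda>k. poly (sturm w k) \<mu>"
  note flux = eigenfunction_flux[OF ef]
  have nc: "\<not> change_at ?p k" if "1 \<le> k" "k < N" for k
    using no_change that by (auto simp: changes_def)
  have pos: "Suc k < N \<Longrightarrow> 0 < ?p (Suc k)" for k
  proof (induction k)
    case (Suc k)
    then show ?case
      using nc[of "Suc k"] nc[of "Suc (Suc k)"]
      by (auto simp: change_at_def mult_less_0_iff not_less simp del: sturm.simps)
  qed simp
  define A where "A = - \<mu> * f 1"
  have A: "A \<noteq> 0" using \<mu> flux(1) by (simp add: A_def)
  have D: "\<exists>q>0. f (Suc x) - f x = A * q" if "1 \<le> x" "x < N" for x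
  proof -
    have "0 < w (x - 1) * ?p x"
      using that pos[of "x - 1"] w[of "x - 1"] c[of x] by simp
    then show ?thesis using flux(3)[OF that] by (auto simp: A_def mult.assoc)
  qed
  show ?thesis
  proof (cases "0 < A")
    case True
    have "f x < f (Suc x)" if "1 \<le> x" "x < N" for x
      using D[OF that] True by (metis diff_gt_0_iff_gt mult_pos_pos)
    then show ?thesis by (intro disjI1 strict_mono_on_atLeastAtMostI)
  next
    case False
    then have "A < 0" using A by simp
    then have "- f x < - f (Suc x)" if "1 \<le> x" "x < N" for x
      using D[OF that] by (metis diff_less_0_iff_less mult_neg_pos neg_less_iff_less)
    then have "strict_mono_on {1..N} (\<lambda>x. - f x)" by (intro strict_mono_on_atLeastAtMostI)
    then show ?thesis by (auto simp: monotone_on_def)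
  qed
qed

end

section \<open>The spectrum and the shape of the eigenfunctions\<close>

theorem proposition1p1:
  fixes N :: nat and c :: "nat \<Rightarrow> nat \<Rightarrow> real"
  assumes "N \<ge> 2"
    and "\<And>x. 1 \<le> x \<Longrightarrow> x < N \<Longrightarrow> c x (x + 1) > 0"
  shows "\<exists>ev :: nat \<Rightarrow> real.
           ev 0 = 0 \<and> strict_mono_on {0..N - 1} ev \<and>
           eigenvalues N (\<lambda>f. - c_laplacian N c f) = ev ` {0..N - 1} \<and>
           (\<forall>g :: nat \<Rightarrow> nat \<Rightarrow> real.
              is_basis N g \<and>
              (\<forall>j\<in>{0..N - 1}. eigenfunction N (\<lambda>f. - c_laplacian N c f) (ev j) (g j)) \<longrightarrow>
              (strict_mono_on {1..N} (g 1) \<or> strict_antimono_on {1..N} (g 1)) \<and>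
              (\<forall>j. 2 \<le> j \<and> j \<le> N - 1 \<longrightarrow> j_monotone N j (g j)))"
proof -
  interpret conductances N c
    using assms by unfold_locales
  have SucN: "Suc (N - 1) = N" using N by simp
  obtain ev where ev0: "ev 0 = 0" and mono: "strict_mono_on {0..N - 1} ev"
    and zeros: "{t. poly (sturm w N) t = 0} = ev ` {1..N - 1}"
    and count: "\<And>t. changes (N - 1) (\<lambda>k. poly (sturm w k) t) = card {i \<in> {1..N - 1}. ev i < t}"
    using sturm_roots[of w "N - 1", OF w_pos] unfolding SucN by (elim exE conjE) (use that in simp)
  let ?L = "\<lambda>f. - c_laplacian N c f"
  have "eigenvalues N ?L = {t. t * poly (sturm w N) t = 0}"
    unfolding eigenvalues_def
    using eigenfunction_flux(2) eigenfunction_sturm by blast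
  also have "\<dots> = insert 0 {t. poly (sturm w N) t = 0}" by auto
  \<comment> \<open>The lower bound \<open>ev 0 = 0\<close> that precedes the roots now serves as
    the eigenvalue of the constants.\<close>
  also have "\<dots> = ev ` insert 0 {1..N - 1}" unfolding zeros by (simp add: ev0)
  also have "insert 0 {1..N - 1} = {0..N - 1}" by auto
  finally have eigs: "eigenvalues N ?L = ev ` {0..N - 1}" .
  have ch: "changes (N - 1) (\<lambda>k. poly (sturm w k) (ev j)) = j - 1" and nz: "ev j \<noteq> 0"
    if "1 \<le> j" "j \<le> N - 1" for j
  proof -
    \<comment> \<open>Only roots strictly below \<open>ev j\<close> count, hence
      \<open>j - 1\<close> and not \<open>j\<close>.\<close>
    have "{i \<in> {1..N - 1}. ev i < ev j} = {1..<j}"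
      using that strict_mono_on_less[OF mono] by auto
    then show "changes (N - 1) (\<lambda>k. poly (sturm w k) (ev j)) = j - 1" using count by simp
    show "ev j \<noteq> 0" using strict_mono_on_less[OF mono, of 0 j] that ev0 by auto
  qed
  have "(strict_mono_on {1..N} (g 1) \<or> strict_antimono_on {1..N} (g 1)) \<and>
      (\<forall>j. 2 \<le> j \<and> j \<le> N - 1 \<longrightarrow> j_monotone N j (g j))"
    if g: "\<forall>j\<in>{0..N - 1}. eigenfunction N ?L (ev j) (g j)" for g
  proof (intro conjI allI impI)
    have "eigenfunction N ?L (ev 1) (g 1)" using g assms(1) by simp
    then show "strict_mono_on {1..N} (g 1) \<or> strict_antimono_on {1..N} (g 1)"
      using eigenfunction_monotone ch[of 1] nz[of 1] assms(1) by simp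
    fix j assume j: "2 \<le> j \<and> j \<le> N - 1"
    then have "eigenfunction N ?L (ev j) (g j)" using g by simp
    then have "card (local_extrema N (g j)) = j - 1"
      using eigenfunction_card_local_extrema ch[of j] nz[of j] j by simp
    then show "j_monotone N j (g j)" using j by (simp add: j_monotone_def)
  qed
  with ev0 mono eigs show ?thesis by blast
qed

end
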